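(* Let $a\in(0,1/2]$ and let $\alpha,\beta$ be real numbers (which may depend on $a$). Then the double inequality $$1+\alpha r'^2<\frac{\mathcal{K}_{a}(r)}{\sin(\pi a)\log\left(e^{R(a)/2}/r'\right)}<1+\beta r'^2$$ holds for all $r\in(0,1)$ if and only if $\alpha\leq \dfrac{\pi}{R(a)\sin(\pi a)}-1$ and $\beta\geq a(1-a)$.
   Context: For $r\in(0,1)$, $r'=\sqrt{1-r^2}$. The generalized elliptic integral of the first kind is $\mathcal{K}_{a}(r)=\frac{\pi}{2}\,{}_2F_1(a,1-a;1;r^2)$, where ${}_2F_1(a,b;c;x)=\sum_{n=0}^{\infty}\frac{(a)_{n}(b)_{n}}{(c)_{n}}\frac{x^n}{n!}$ for $-1<x<1$, with $(a)_n=\Gamma(a+n)/\Gamma(a)$, is the Gaussian hypergeometric function. The Ramanujan constant function is $R(x)=-2\gamma-\Psi(x)-\Psi(1-x)$ for $x\in(0,1/2]$ (so $R(1/2)=4\log 2$), where $\gamma=\lim_{n\to\infty}\left(\sum_{k=1}^n 1/k-\log n\right)$ is the Euler-Mascheroni constant and $\Psi(x)=\Gamma'(x)/\Gamma(x)$ is the digamma function. *)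

theory Defs
  imports "HOL-Analysis.Analysis"
begin

text \<open>Gaussian hypergeometric function, meant for real arguments with
  \<open>-1 < x < 1\<close> and \<open>c\<close> not a non-positive integer. The shifted factorial
  \<open>(a)\<^sub>n = Gamma (a + n) / Gamma a\<close> is \<^const>\<open>pochhammer\<close>; see
  \<open>pochhammer_Gamma\<close>.\<close>

definition hypergeo2F1 :: "real \<Rightarrow> real \<Rightarrow> real \<Rightarrow> real \<Rightarrow> real" where
  "hypergeo2F1 a b c x =
     (\<Sum>n. pochhammer a n * pochhammer b n / pochhammer c n * x ^ n / fact n)"

definition gen_ellipticK :: "real \<Rightarrow> real \<Rightarrow> real" where
  "gen_ellipticK a r = pi / 2 * hypergeo2F1 a (1 - a) 1 (r\<^sup>2)"

definition compl_modulus :: "real \<Rightarrow> real" where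
  "compl_modulus r = sqrt (1 - r\<^sup>2)"

definition ramanujan_R :: "real \<Rightarrow> real" where
  "ramanujan_R x = - 2 * euler_mascheroni - Digamma x - Digamma (1 - x)"

lemma ramanujan_R_half: "ramanujan_R (1/2) = 4 * ln 2"
  using Digamma_one_half[where 'a = real] by (simp add: ramanujan_R_def)

end

(* Put x = r'^2, R = R(a), p = a(1-a), t = pi/sin(pi a), and let Y(x) = t F(a,1-a;1;1-x), so that the
   quotient is Y/(R - ln x). The hypergeometric equation reads (x(1-x)Y')' = p Y. For
   v = Y - (R - ln x)(1 + g x) and the flux q = x(1-x)v' it becomes q' = p v + h with an explicit
   elementary h. Gauss's logarithmic asymptotics Y = R - ln x + o(1) gives v, q -> 0 at x = 0, so
   v > 0 near 0 where h > 0, and from there on a maximum principle combined with the sign pattern of h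
   shows v > 0 for g = t/R - 1 and v < 0 for g = p. The same argument near 0 excludes every g < p in
   the upper bound, and the value at x = 1 gives the optimality of t/R - 1. The boundary
   behaviour at x = 1 needs R < t < (1+p)R and R < (1+p)t - t/R, which follow from
   estimating R and t as functions of p. *)

theory Submission
  imports Defs "HOL-Real_Asymp.Real_Asymp"
begin

section \<open>Zero-balanced beta coefficients\<close>

text \<open>Gauss's asymptotics is reached through the coefficients: R has to be identified as the
  sum of the \<open>d n - 1 / n\<close>. For this the coefficients of B(x,b) F(x,b;x+b;z) are
  studied with x free, although only x = a, b = 1 - a is wanted: shifts of x then become available.
  The lower bound is the harder one. For g = t/R - 1 the function v vanishes at both ends, while h
  is positive near both ends but can be negative between them, so no single comparison covers the
  interval. The way out is that h is nonnegative at a nonpositive minimum of v, and that this point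
  cuts off an end interval on which h stays nonnegative. The estimates of the constants are delicate
  because p R and p t are both 1 - p + O(p^2): R < t and the inequality with t/R are decided by the
  terms in p^2 alone.\<close>

definition beta_coeff :: "real \<Rightarrow> real \<Rightarrow> nat \<Rightarrow> real" where
  "beta_coeff b x n = Beta (x + real n) b * pochhammer b n / fact n"

lemma pos_notin_nonpos_Ints: "0 < x \<Longrightarrow> (x::real) \<notin> \<int>\<^sub>\<le>\<^sub>0"
  by (auto elim!: nonpos_Ints_cases)

lemma Beta_real_pos: "0 < x \<Longrightarrow> 0 < y \<Longrightarrow> 0 < Beta x (y::real)"
  by (simp add: Beta_def Gamma_real_pos)

lemma Beta_real_Suc:
  fixes x y :: real
  assumes "0 < x" "0 < y"
  shows "Beta (x + 1) y = x / (x + y) * Beta x y"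
  using Beta_plus1_left[OF pos_notin_nonpos_Ints, of x y] assms by (simp add: field_simps)

lemma beta_coeff_pos: "0 < b \<Longrightarrow> 0 < x \<Longrightarrow> 0 < beta_coeff b x n"
  unfolding beta_coeff_def
  by (intro divide_pos_pos mult_pos_pos Beta_real_pos pochhammer_pos) auto

lemma beta_coeff_add_one:
  assumes "0 < b" "0 < x"
  shows "beta_coeff b (x + 1) n = (x + n) / (x + n + b) * beta_coeff b x n"
  using Beta_real_Suc[of "x + n" b] assms by (simp add: beta_coeff_def add_ac)

lemma beta_coeff_Suc:
  assumes "0 < b" "0 < x"
  shows "beta_coeff b x (Suc n) =
           (x + n) * (b + n) / ((x + n + b) * (n + 1)) * beta_coeff b x n"
  using Beta_real_Suc[of "x + n" b] assms
  by (simp add: beta_coeff_def add_ac pochhammer_Suc mult_ac)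

lemma beta_coeff_antimono:
  assumes "0 < b" "0 < x" "x \<le> y"
  shows "beta_coeff b y n \<le> beta_coeff b x n"
  unfolding beta_coeff_def using assms
  by (intro divide_right_mono mult_right_mono Beta_real_mono pochhammer_nonneg) auto

text \<open>The anchor for all comparisons in x: at x = 1 the coefficient is explicit.\<close>

lemma beta_coeff_one: "0 < b \<Longrightarrow> beta_coeff b 1 n = 1 / (b + n)"
proof (induction n)
  case 0
  then show ?case
    using Gamma_plus1[OF pos_notin_nonpos_Ints, of b] Gamma_real_pos[of b, THEN less_imp_neq]
    by (simp add: beta_coeff_def Beta_def add_ac)
next
  case (Suc n)
  have "b + real n > 0" "1 + real n + b > 0" using Suc.prems by auto
  then show ?case using Suc by (simp add: beta_coeff_Suc add_ac)
qed

text \<open>Gosper's algorithm: \<open>n * beta_coeff b x n / x\<close> is an antidifference of the summand.\<close>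

lemma sum_beta_coeff_add_one:
  assumes "0 < b" "0 < x"
  shows "(\<Sum>n<N. beta_coeff b x n) - (\<Sum>n<N. beta_coeff b (x + 1) n) = N * beta_coeff b x N / x"
proof (induction N)
  case (Suc N)
  have "beta_coeff b x N - beta_coeff b (x + 1) N = b / (x + N + b) * beta_coeff b x N"
  proof -
    have "x + N + b > 0" using assms by simp
    then show ?thesis using assms by (simp add: beta_coeff_add_one divide_simps) (simp add: algebra_simps)
  qed
  moreover have "Suc N * beta_coeff b x (Suc N) = (x + N) * (b + N) / (x + N + b) * beta_coeff b x N"
    using assms by (simp add: beta_coeff_Suc add.commute)
  then have "Suc N * beta_coeff b x (Suc N) / x - N * beta_coeff b x N / x
      = ((x + N) * (b + N) / (x + N + b) - N) / x * beta_coeff b x N"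
    by (simp only:) (simp add: diff_divide_distrib left_diff_distrib)
  moreover have "((x + real N) * (b + real N) / (x + real N + b) - real N) / x = b / (x + N + b)"
  proof -
    have "x + N + b > 0" using assms by simp
    then show ?thesis using assms by (simp add: divide_simps) (simp add: algebra_simps)
  qed
  ultimately show ?case using Suc.IH by simp
qed simp

lemma beta_coeff_limit_add_one_iff:
  assumes "0 < b" "0 < x"
  shows "(\<lambda>n. n * beta_coeff b (x + 1) n) \<longlonglongrightarrow> 1 \<longleftrightarrow> (\<lambda>n. n * beta_coeff b x n) \<longlonglongrightarrow> 1"
proof
  have lim: "(\<lambda>n. (x + real n) / (x + real n + b)) \<longlonglongrightarrow> 1" by real_asymp
  have lim': "(\<lambda>n. (x + real n + b) / (x + real n)) \<longlonglongrightarrow> 1" by real_asymp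
  show "(\<lambda>n. n * beta_coeff b (x + 1) n) \<longlonglongrightarrow> 1" if "(\<lambda>n. n * beta_coeff b x n) \<longlonglongrightarrow> 1"
    using tendsto_mult[OF lim that] assms by (simp add: beta_coeff_add_one mult_ac)
  show "(\<lambda>n. n * beta_coeff b x n) \<longlonglongrightarrow> 1" if "(\<lambda>n. n * beta_coeff b (x + 1) n) \<longlonglongrightarrow> 1"
  proof -
    have "(\<lambda>n. (x + real n + b) / (x + real n) * (n * beta_coeff b (x + 1) n))
        = (\<lambda>n. n * beta_coeff b x n)"
    proof
      fix n
      have "x + real n + b > 0" "x + real n > 0" using assms by auto
      then show "(x + real n + b) / (x + real n) * (n * beta_coeff b (x + 1) n) = n * beta_coeff b x n"
        using assms by (simp add: beta_coeff_add_one)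
    qed
    then show ?thesis using tendsto_mult[OF lim' that] by simp
  qed
qed

text \<open>The limit is explicit at x = 1, hence known at 2 by the shift. Since x + 1 lies between
  1 and 2, monotonicity squeezes it there, and the shift carries the limit back to x and on to every
  x + k.\<close>

lemma beta_coeff_limit:
  assumes b: "0 < b" and x: "0 < x" "x \<le> 1"
  shows "(\<lambda>n. n * beta_coeff b (x + real k) n) \<longlonglongrightarrow> 1"
proof (induction k)
  case 0
  have one: "(\<lambda>n. n * beta_coeff b 1 n) \<longlonglongrightarrow> 1"
    using b by (simp add: beta_coeff_one) real_asymp
  then have two: "(\<lambda>n. n * beta_coeff b (1 + 1) n) \<longlonglongrightarrow> 1"
    using beta_coeff_limit_add_one_iff[of b 1] b by simp
  have "(\<lambda>n. n * beta_coeff b (x + 1) n) \<longlonglongrightarrow> 1"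
    by (rule tendsto_sandwich[OF _ _ two one])
       (use b x in \<open>auto intro!: always_eventually mult_left_mono beta_coeff_antimono\<close>)
  then show ?case using beta_coeff_limit_add_one_iff b x by simp
next
  case (Suc k)
  then show ?case
    using beta_coeff_limit_add_one_iff[of b "x + real k"] b x by (simp add: add_ac)
qed

text \<open>Each shift costs the boundary term \<open>N * beta_coeff b x N / x\<close>, which tends
  to 1/x.\<close>

lemma sum_beta_coeff_shift_limit:
  assumes b: "0 < b" and x: "0 < x" "x \<le> 1"
    and lim: "(\<lambda>N. (\<Sum>n<N. beta_coeff b x n) - harm N) \<longlonglongrightarrow> A"
  shows "(\<lambda>N. (\<Sum>n<N. beta_coeff b (x + real k) n) - harm N) \<longlonglongrightarrow> A - (\<Sum>j<k. 1 / (x + real j))"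
proof (induction k)
  case 0
  then show ?case using lim by simp
next
  case (Suc k)
  have "(\<lambda>N. (\<Sum>n<N. beta_coeff b (x + real k) n) - harm N
            - N * beta_coeff b (x + real k) N / (x + real k))
        \<longlonglongrightarrow> A - (\<Sum>j<k. 1 / (x + real j)) - 1 / (x + k)"
    by (intro tendsto_diff Suc.IH tendsto_divide beta_coeff_limit) (use b x in auto)
  moreover have "(\<Sum>n<N. beta_coeff b (x + real (Suc k)) n) =
      (\<Sum>n<N. beta_coeff b (x + real k) n) - N * beta_coeff b (x + real k) N / (x + real k)" for N
    using sum_beta_coeff_add_one[of b "x + real k" N] b x by (simp add: add_ac)
  ultimately show ?case by (simp add: diff_diff_eq add.commute)
qed

lemma sums_minus_Digamma:
  fixes x :: real
  assumes "0 < x"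
  shows "(\<lambda>n. 1 / (x + n) - 1 / (n + 1)) sums (- euler_mascheroni - Digamma x)"
proof -
  have "summable (\<lambda>n. inverse (of_nat (Suc n)) - inverse (x + of_nat n))"
    by (rule summable_Digamma) (use assms in auto)
  then have "(\<lambda>n. inverse (of_nat (Suc n)) - inverse (x + of_nat n)) sums
      (Digamma x + euler_mascheroni)"
    using summable_sums by (fastforce simp: Digamma_def)
  from sums_minus[OF this] show ?thesis by (simp add: inverse_eq_divide add_ac)
qed

text \<open>The shift \<open>x \<rightarrow> x + 1\<close> changes the limit by \<open>1 / x\<close>, just as \<^term>\<open>- Digamma x\<close>, and
  the summands are antimonotone in \<open>x\<close>: as in the Bohr-Mollerup theorem, comparing \<open>x + k\<close> with
  the integers \<open>k\<close> and \<open>k + 1\<close> determines the limit.\<close>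

lemma sum_beta_coeff_limit_unique:
  assumes b: "0 < b" and x: "0 < x" "x \<le> 1"
    and lim: "(\<lambda>N. (\<Sum>n<N. beta_coeff b x n) - harm N) \<longlonglongrightarrow> A"
  shows "A = - 2 * euler_mascheroni - Digamma x - Digamma b"
proof -
  define A1 where "A1 = - euler_mascheroni - Digamma b"
  have harm: "harm N = (\<Sum>n<N. 1 / (real n + 1))" for N
    by (induction N) (simp_all add: harm_Suc harm_def field_simps)
  have one: "(\<lambda>N. (\<Sum>n<N. beta_coeff b 1 n) - harm N) \<longlonglongrightarrow> A1"
    using sums_minus_Digamma[OF b] b
    by (simp add: sums_def A1_def beta_coeff_one harm sum_subtractf)
  define D where "D = (\<lambda>k. \<Sum>j<k. 1 / (x + real j) - 1 / (real j + 1))"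
  have D: "D k = (\<Sum>j<k. 1 / (x + real j)) - harm k" for k
    by (simp add: D_def harm sum_subtractf)
  \<comment> \<open>\<open>le\<close> rests on x + k <= 1 + k and \<open>ge\<close> on 1 + k <= x +
    (k + 1); together they leave a gap of 1/(x + k).\<close>
  have le: "A - A1 \<ge> D k" for k
  proof -
    have "A1 - (\<Sum>j<k. 1 / (1 + real j)) \<le> A - (\<Sum>j<k. 1 / (x + real j))"
      by (rule tendsto_le[OF _ sum_beta_coeff_shift_limit[OF b x lim]
            sum_beta_coeff_shift_limit[OF b _ _ one]])
         (use b x in \<open>auto intro!: always_eventually sum_mono beta_coeff_antimono\<close>)
    then show ?thesis by (simp add: D harm add_ac)
  qed
  have ge: "A - A1 \<le> D (Suc k) + 1 / (real k + 1)" for k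
  proof -
    have "A - (\<Sum>j<Suc k. 1 / (x + real j)) \<le> A1 - (\<Sum>j<k. 1 / (1 + real j))"
      by (rule tendsto_le[OF _ sum_beta_coeff_shift_limit[OF b _ _ one]
            sum_beta_coeff_shift_limit[OF b x lim]])
         (use b x in \<open>auto intro!: always_eventually sum_mono beta_coeff_antimono\<close>)
    then show ?thesis by (simp add: D harm add_ac)
  qed
  have lD: "D \<longlonglongrightarrow> - euler_mascheroni - Digamma x"
    using sums_minus_Digamma[OF x(1)] by (simp add: sums_def D_def)
  have "(\<lambda>k. D (Suc k) + 1 / (real k + 1)) \<longlonglongrightarrow> (- euler_mascheroni - Digamma x) + 0"
    by (intro tendsto_add LIMSEQ_Suc lD) real_asymp
  then have "A - A1 \<le> - euler_mascheroni - Digamma x"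
    by (intro LIMSEQ_le_const) (use ge in auto)
  moreover have "A - A1 \<ge> - euler_mascheroni - Digamma x"
    by (rule LIMSEQ_le_const2[OF lD]) (use le in auto)
  ultimately show ?thesis by (simp add: A1_def)
qed

section \<open>The constants\<close>

lemma telescoping_inverse_sums: "(\<lambda>n. 1 / (n + 1) - 1 / (n + 2) :: real) sums 1"
proof -
  have "(\<lambda>n. 1 / (real n + 1)) \<longlonglongrightarrow> 0" by real_asymp
  from telescope_sums'[OF this] show ?thesis by (simp add: add_ac)
qed

lemma telescoping_inverse_square_sums:
  fixes c :: real
  assumes "0 < c"
  shows "(\<lambda>n. 1 / (n + c)\<^sup>2 - 1 / (n + (c + 1))\<^sup>2) sums (1 / c\<^sup>2)"
proof -
  have "(\<lambda>n. 1 / (real n + c)\<^sup>2) \<longlonglongrightarrow> 0" by real_asymp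
  from telescope_sums'[OF this] show ?thesis by (simp add: add_ac)
qed

section \<open>Coefficients of Y, the sum that equals R, and bounds for t\<close>

locale elliptic_parameter =
  fixes a :: real
  assumes a_pos: "0 < a" and a_le: "a \<le> 1/2"
begin

definition p :: real where "p = a * (1 - a)"
definition t :: real where "t = pi / sin (pi * a)"
definition R :: real where "R = ramanujan_R a"
definition d :: "nat \<Rightarrow> real" where "d n = beta_coeff (1 - a) a n"

lemma p_pos: "0 < p" using a_pos a_le by (simp add: p_def)

lemma p_le: "p \<le> 1/4"
proof -
  have "1/4 - p = (1/2 - a)\<^sup>2" by (simp add: p_def power2_eq_square algebra_simps)
  then show ?thesis using zero_le_power2[of "1/2 - a"] by linarith
qed

lemma sin_pos: "0 < sin (pi * a)"
  using a_pos a_le by (intro sin_gt_zero) (auto intro: mult_pos_pos)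

lemma t_pos: "0 < t" using sin_pos by (simp add: t_def)

lemma d_pos: "0 < d n"
  using a_pos a_le by (simp add: d_def beta_coeff_pos)

text \<open>B(a, 1 - a) is Gamma(a) Gamma(1 - a), so this is Euler's reflection formula, taken in
  its complex form and pulled back to the reals.\<close>

lemma d_0: "d 0 = t"
proof -
  have "complex_of_real (Gamma a * Gamma (1 - a)) = of_real t"
    using Gamma_reflection_complex[of "of_real a"]
    by (simp add: t_def flip: Gamma_complex_of_real sin_of_real)
  then show ?thesis by (simp only: of_real_eq_iff) (simp add: d_def beta_coeff_def Beta_def)
qed

text \<open>From here on a enters the coefficients only through p, because (a + n)(1 - a + n) = n(n
  + 1) + p.\<close>

lemma d_Suc: "d (Suc n) = (real n * (real n + 1) + p) / (real n + 1)\<^sup>2 * d n"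
  using beta_coeff_Suc[of "1 - a" a n] a_pos a_le
  by (simp add: d_def p_def power2_eq_square algebra_simps)

lemma d_eq: "d n = t * (pochhammer a n * pochhammer (1 - a) n / (fact n)\<^sup>2)"
proof (induction n)
  case (Suc n)
  have "real n * (real n + 1) + p = (a + n) * (1 - a + n)" by (simp add: p_def algebra_simps)
  then have "d (Suc n) = (a + n) * (1 - a + n) / (real n + 1)\<^sup>2 * d n" by (simp only: d_Suc)
  then show ?case
    by (simp only: Suc.IH) (simp add: pochhammer_Suc power_mult_distrib add_ac mult_ac)
qed (simp add: d_0)

text \<open>This rescaling tends to 1 and has a product recurrence with factors 1 + O(1/n^2), so its
  distance from 1 can be controlled.\<close>

definition u :: "nat \<Rightarrow> real" where "u n = real (Suc n) * d (Suc n)"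

lemma u_0: "u 0 = p * t"
  using d_Suc[of 0] by (simp add: u_def d_0)

lemma u_Suc: "u (Suc n) = u n * (1 + p / ((real n + 1) * (real n + 2)))"
proof -
  define x where "x = real n + 2"
  have x: "x > 0" "x \<noteq> 1" by (auto simp: x_def)
  have "u (Suc n) = x * (((x - 1) * x + p) / x\<^sup>2 * d (Suc n))"
    using d_Suc[of "Suc n"] by (simp add: u_def x_def add_ac)
  also have "\<dots> = (x - 1) * d (Suc n) * (1 + p / ((x - 1) * x))"
    using x by (simp add: power2_eq_square field_simps)
  finally show ?thesis by (simp add: u_def x_def add_ac)
qed

lemma u_pos: "0 < u n"
  using d_pos[of "Suc n"] by (simp add: u_def)

lemma u_limit: "u \<longlonglongrightarrow> 1"
proof -
  have "(\<lambda>n. real (Suc n) * beta_coeff (1 - a) a (Suc n)) \<longlonglongrightarrow> 1"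
    using LIMSEQ_Suc[OF beta_coeff_limit[of "1 - a" a 0]] a_pos a_le by simp
  then show ?thesis by (simp add: d_def u_def[abs_def])
qed

lemma u_le: "u n \<le> 1"
proof -
  have "incseq u"
  proof (rule incseq_SucI)
    fix n
    have "u n * 1 \<le> u n * (1 + p / ((real n + 1) * (real n + 2)))"
      using p_pos u_pos[of n] by (intro mult_left_mono) auto
    then show "u n \<le> u (Suc n)" by (simp add: u_Suc)
  qed
  from incseq_le[OF this u_limit] show ?thesis .
qed

text \<open>The added term p/(n + 1) is the telescoped tail of the sum of p/(k(k + 1)); since u <=
  1, it turns the increasing u into a decreasing sequence. The rate 1/n is what makes
  \<open>e\<close> absolutely summable.\<close>

lemma u_ge: "u n \<ge> 1 - p / (real n + 1)"
proof -
  let ?f = "\<lambda>n. u n + p / (real n + 1)"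
  have "(\<lambda>n. p / (real n + 1)) \<longlonglongrightarrow> 0" by real_asymp
  from tendsto_add[OF u_limit this] have lim: "?f \<longlonglongrightarrow> 1" by simp
  have "decseq ?f"
  proof (rule decseq_SucI)
    fix n
    have "u n * (p / ((real n + 1) * (real n + 2))) \<le> 1 * (p / ((real n + 1) * (real n + 2)))"
      using p_pos u_le[of n] by (intro mult_right_mono) auto
    also have "\<dots> = p / (real n + 1) - p / (real n + 2)"
      by (simp add: field_simps)
    finally show "?f (Suc n) \<le> ?f n"
      by (simp add: u_Suc distrib_left add_ac)
  qed
  from decseq_ge[OF this lim, of n] show ?thesis by simp
qed

text \<open>As \<open>1 / 0 = 0\<close>, the term \<open>e 0\<close> is \<open>d 0\<close>, and the logarithmic series \<open>\<Sum>z^n/n\<close> may start at \<open>0\<close>.\<close>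

definition e :: "nat \<Rightarrow> real" where "e n = d n - 1 / n"

lemma summable_abs_e: "summable (\<lambda>n. \<bar>e n\<bar>)"
proof -
  have "summable (\<lambda>n. 1 / (real (Suc n))\<^sup>2)"
    using summable_Suc_iff[THEN iffD2, OF inverse_power_summable[of 2, where 'a = real]]
    by (simp add: inverse_eq_divide del: of_nat_Suc)
  then have "summable (\<lambda>n. \<bar>e (Suc n)\<bar>)"
  proof (rule summable_comparison_test_ev[rotated], intro always_eventually allI)
    fix n
    have "Suc n * e (Suc n) = u n - 1" by (simp add: e_def u_def right_diff_distrib)
    then have "\<bar>Suc n * e (Suc n)\<bar> = \<bar>u n - 1\<bar>" by (simp only:)
    then have "Suc n * \<bar>e (Suc n)\<bar> = \<bar>u n - 1\<bar>" by (simp only: abs_mult abs_of_nat)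
    also have "\<dots> \<le> p / Suc n"
      using u_le[of n] u_ge[of n] by (simp add: add_ac)
    also have "\<dots> \<le> 1 / Suc n" using p_le by (intro divide_right_mono) auto
    finally show "norm \<bar>e (Suc n)\<bar> \<le> 1 / (real (Suc n))\<^sup>2"
      by (simp add: power2_eq_square pos_le_divide_eq mult_ac del: of_nat_Suc)
  qed
  then show ?thesis by (rule summable_Suc_iff[of "\<lambda>n. \<bar>e n\<bar>", THEN iffD1])
qed

lemma e_sums: "e sums R"
proof -
  have "summable e" using summable_abs_e by (rule summable_rabs_cancel)
  then have "(\<lambda>N. \<Sum>n<N. e n) \<longlonglongrightarrow> suminf e"
    by (simp add: summable_LIMSEQ)
  moreover have "(\<lambda>N. 1 / real N) \<longlonglongrightarrow> 0" by real_asymp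
  ultimately have "(\<lambda>N. (\<Sum>n<N. e n) - 1 / N) \<longlonglongrightarrow> suminf e - 0" by (rule tendsto_diff)
  \<comment> \<open>The sum of 1/n over n < N stops at 1/(N - 1), whereas \<open>harm N\<close>
    includes 1/N.\<close>
  moreover have "(\<Sum>n<N. e n) - 1 / N = (\<Sum>n<N. d n) - harm N" for N
  proof (cases N)
    case (Suc m)
    have "(\<Sum>n<m. 1 / real (Suc n)) + 1 / Suc m = harm (Suc m)"
      by (induction m) (simp_all add: harm_Suc inverse_eq_divide harm_expand(1))
    then have "(\<Sum>n<N. 1 / real n) + 1 / N = harm N"
      unfolding Suc sum.lessThan_Suc_shift by simp
    then show ?thesis unfolding e_def sum_subtractf by linarith
  qed (simp add: harm_def)
  ultimately have "(\<lambda>N. (\<Sum>n<N. beta_coeff (1 - a) a n) - harm N) \<longlonglongrightarrow> suminf e"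
    by (simp add: d_def)
  then have "suminf e = R"
    using sum_beta_coeff_limit_unique[of "1 - a" a] a_pos a_le by (simp add: R_def ramanujan_R_def)
  then show ?thesis using \<open>summable e\<close> by (simp add: sums_iff)
qed

text \<open>The bounds for \<open>t\<close> come from \<open>u n = p t \<Prod>\<^sub>k\<^sub>\<le>\<^sub>n (1 + p/(k(k+1)))\<close> and \<open>u n \<rightarrow> 1\<close>, by estimating the
  tail of the product.\<close>

lemma t_upper: "p * t * (1 + p/2)\<^sup>2 \<le> 1"
proof -
  \<comment> \<open>The factor k = 1 is kept; the later ones multiply to at least 1 plus p times the
    sum of 1/(k(k + 1)) from k = 2 on, which telescopes to 1/2.\<close>
  have *: "p * t * (1 + p/2) * (1 + p * (1/2 - 1 / (real n + 2))) \<le> u (n + 1)" for n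
  proof (induction n)
    case 0
    show ?case using u_Suc[of 0] u_0 by simp
  next
    case (Suc n)
    define s where "s = 1/2 - 1 / (real n + 2)"
    define q where "q = 1 / ((real n + 2) * (real n + 3))"
    have s: "s \<ge> 0" "q \<ge> 0" by (auto simp: s_def q_def field_simps)
    have eq: "1/2 - 1 / (real n + 3) = s + q"
      by (simp add: s_def q_def divide_simps) (simp add: algebra_simps)
    have "p * t * (1 + p/2) * (1 + p * (s + q)) \<le> p * t * (1 + p/2) * ((1 + p * s) * (1 + p * q))"
      using p_pos t_pos s by (intro mult_left_mono) (auto simp: algebra_simps)
    also have "\<dots> \<le> u (n + 1) * (1 + p * q)"
      using mult_right_mono[OF Suc.IH, of "1 + p * q"] s p_pos by (simp add: s_def mult_ac)
    also have "\<dots> = u (n + 2)"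
      using u_Suc[of "Suc n"] by (simp add: q_def add_ac)
    finally show ?case using eq by (simp add: add_ac)
  qed
  have "(\<lambda>n. 1 / (real n + 2)) \<longlonglongrightarrow> 0" by real_asymp
  then have "(\<lambda>n. p * t * (1 + p/2) * (1 + p * (1/2 - 1 / (real n + 2)))) \<longlonglongrightarrow>
      p * t * (1 + p/2) * (1 + p * (1/2 - 0))"
    by (intro tendsto_intros)
  moreover have "(\<lambda>n. u (n + 1)) \<longlonglongrightarrow> 1"
    using LIMSEQ_Suc[OF u_limit] by simp
  ultimately have "p * t * (1 + p/2) * (1 + p * (1/2 - 0)) \<le> 1"
    by (rule LIMSEQ_le) (use * in auto)
  then show ?thesis by (simp add: power2_eq_square mult_ac)
qed

text \<open>Three factors are kept; for the rest, the product of the 1 + x_k times 1 minus the sum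
  of the x_k is at most 1, and the sum of 1/(k(k + 1)) from k = 4 on is 1/4. With only two factors
  kept, the constant 53/100 in \<open>t_bounds\<close> would be missed at p = 1/4.\<close>

lemma t_lower: "1 - p/4 \<le> p * t * ((1 + p/2) * (1 + p/6) * (1 + p/12))"
proof -
  define P where "P = (1 + p/2) * (1 + p/6) * (1 + p/12)"
  have *: "u (n + 3) * (1 - p * (1/4 - 1 / (real n + 4))) \<le> p * t * P" for n
  proof (induction n)
    case 0
    have "u 3 = p * t * P"
      using u_Suc[of 0] u_Suc[of 1] u_Suc[of 2] by (simp add: P_def u_0 numeral_2_eq_2 numeral_3_eq_3)
    then show ?case by simp
  next
    case (Suc n)
    define s where "s = 1/4 - 1 / (real n + 4)"
    define q where "q = 1 / ((real n + 4) * (real n + 5))"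
    have s: "s \<ge> 0" "q \<ge> 0" by (auto simp: s_def q_def field_simps)
    have eq: "1/4 - 1 / (real n + 5) = s + q"
      by (simp add: s_def q_def divide_simps) (simp add: algebra_simps)
    have "(1 + p * q) * (1 - p * (s + q)) = (1 - p * s) - p\<^sup>2 * q * (s + q)"
      by (simp add: power2_eq_square algebra_simps)
    also have "\<dots> \<le> 1 - p * s" using s p_pos by simp
    finally have "u (n + 3) * ((1 + p * q) * (1 - p * (s + q))) \<le> u (n + 3) * (1 - p * s)"
      using u_pos[of "n + 3"] by (intro mult_left_mono) auto
    also have "\<dots> \<le> p * t * P" using Suc.IH by (simp add: s_def)
    finally have "u (n + 3) * (1 + p * q) * (1 - p * (s + q)) \<le> p * t * P"
      by (simp only: mult.assoc)
    moreover have "u (n + 3) * (1 + p * q) = u (Suc n + 3)"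
      using u_Suc[of "n + 3"] by (simp add: q_def add_ac)
    ultimately have "u (Suc n + 3) * (1 - p * (1/4 - 1 / (real n + 5))) \<le> p * t * P"
      by (simp only: eq)
    moreover have "real (Suc n) + 4 = real n + 5" by simp
    ultimately show ?case by (simp only:)
  qed
  have "(\<lambda>n. u (n + 3)) \<longlonglongrightarrow> 1"
    by (rule LIMSEQ_ignore_initial_segment[OF u_limit])
  moreover have "(\<lambda>n. 1 / (real n + 4)) \<longlonglongrightarrow> 0" by real_asymp
  then have "(\<lambda>n. 1 - p * (1/4 - 1 / (real n + 4))) \<longlonglongrightarrow> 1 - p * (1/4 - 0)"
    by (intro tendsto_intros)
  ultimately have "(\<lambda>n. u (n + 3) * (1 - p * (1/4 - 1 / (real n + 4)))) \<longlonglongrightarrow> 1 * (1 - p * (1/4 - 0))"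
    by (rule tendsto_mult)
  from LIMSEQ_le_const2[OF this] * show ?thesis by (auto simp: P_def)
qed

text \<open>The shape 1 - p + s p^2 is chosen to be comparable with \<open>R_bounds\<close>. At p =
  1/4 the exact value p t = pi/4 means s = 0.566..., so 53/100 is close to the truth.\<close>

lemma t_bounds: "p * t \<le> 1 - p + 3/4 * p\<^sup>2" "1 - p + 53/100 * p\<^sup>2 \<le> p * t"
proof -
  have "1 \<le> (1 - p + 3/4 * p\<^sup>2) * (1 + p/2)\<^sup>2"
  proof -
    have "(1 - p + 3/4 * p\<^sup>2) * (1 + p/2)\<^sup>2 = 1 + p^3/2 + 3/16 * p^4" by (simp add: eval_nat_numeral field_simps)
    then show ?thesis using p_pos by simp
  qed
  with t_upper have "p * t * (1 + p/2)\<^sup>2 \<le> (1 - p + 3/4 * p\<^sup>2) * (1 + p/2)\<^sup>2" by linarith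
  then show "p * t \<le> 1 - p + 3/4 * p\<^sup>2"
    by (rule mult_right_le_imp_le) (use p_pos in simp)
  let ?P = "(1 + p/2) * (1 + p/6) * (1 + p/12)"
  have "(1 - p + 53/100 * p\<^sup>2) * ?P \<le> 1 - p/4"
  proof -
    have "1 - p/4 - (1 - p + 53/100 * p\<^sup>2) * ?P
        = p\<^sup>2 * (73/900 - 239/900 * p - 12/180 * p^2 - 53/14400 * p^3)" by (simp add: eval_nat_numeral field_simps)
    moreover have "239/900 * p \<le> 239/900 * (1/4)" "12/180 * p^2 \<le> 12/180 * (1/4)^2"
        "53/14400 * p^3 \<le> 53/14400 * (1/4)^3"
      using p_le p_pos by (intro mult_left_mono power_mono; simp)+
    then have "0 \<le> 73/900 - 239/900 * p - 12/180 * p^2 - 53/14400 * p^3"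
      by (simp add: power_divide)
    then have "0 \<le> p\<^sup>2 * (73/900 - 239/900 * p - 12/180 * p^2 - 53/14400 * p^3)"
      by (intro mult_nonneg_nonneg) auto
    ultimately show ?thesis by linarith
  qed
  with t_lower have "(1 - p + 53/100 * p\<^sup>2) * ?P \<le> p * t * ?P" by linarith
  moreover have "?P > 0" using p_pos by (intro mult_pos_pos) auto
  ultimately show "1 - p + 53/100 * p\<^sup>2 \<le> p * t"
    by (rule mult_right_le_imp_le)
qed

end

section \<open>Bounds for R and the inequalities between R and t\<close>

context elliptic_parameter begin

text \<open>The Digamma series for R has first term 1/p - 2. The rest is a telescoping series of sum
  1 minus a series of order p, whose terms are again nearly telescoping.\<close>

lemma R_bounds: "1 - p - p\<^sup>2 \<le> p * R" "p * R \<le> 1 - p - 9/10 * p\<^sup>2"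
proof -
  define f where "f n = (1 / (a + real n) - 1 / (real n + 1)) + (1 / (1 - a + real n) - 1 / (real n + 1))" for n
  have f: "f sums R"
    using sums_add[OF sums_minus_Digamma[of a] sums_minus_Digamma[of "1 - a"]] a_pos a_le
    by (simp add: f_def[abs_def] R_def ramanujan_R_def algebra_simps)
  have f0: "f 0 = 1 / p - 2"
    using a_pos a_le by (simp add: f_def p_def field_simps)
  \<comment> \<open>The telescoping term subtracted here is \<open>f (Suc n)\<close> at a = 0, which
    is why the difference carries a factor p.\<close>
  have f_Suc: "1 / (real n + 1) - 1 / (real n + 2) - f (Suc n)
      = p * ((2 * x - 1) / ((x - 1) * x * ((x - 1) * x + p)))" if x_def: "x = real n + 2" for n x
  proof -
    have x: "x - 1 > 0" "x > 0" "a + (x - 1) > 0" "x - a > 0"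
      using a_pos a_le by (auto simp: x_def)
    have "(x - 1) * x + p = (a + (x - 1)) * (x - a)" by (simp add: p_def algebra_simps)
    then show ?thesis
      using x unfolding f_def p_def by (simp add: x_def divide_simps) (simp add: algebra_simps)
  qed
  define g where "g n = 1 / (real n + 1) - 1 / (real n + 2) - f (Suc n)" for n
  have g: "g sums (1 / p - 1 - R)"
  proof -
    have "(\<lambda>n. f (Suc n)) sums (R - f 0)" using f by (simp add: sums_Suc_iff)
    from sums_diff[OF telescoping_inverse_sums this] show ?thesis
      by (simp add: g_def[abs_def] f0 algebra_simps)
  qed
  have g_eq: "g n = p * (1 / (real n + 1)\<^sup>2 - 1 / (real n + 2)\<^sup>2) * (m / (m + p))"
    if m_def: "m = (real n + 1) * (real n + 2)" for n m
  proof -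
    define x where "x = real n + 2"
    have x: "x - 1 > 0" "x > 0" and m: "m = (x - 1) * x" "m > 0" "m + p > 0"
      using p_pos by (auto simp: x_def m_def add_pos_pos)
    have "1 / (x - 1)\<^sup>2 - 1 / x\<^sup>2 = (2 * x - 1) / m\<^sup>2"
      using x by (simp add: m divide_simps) (simp add: power2_eq_square algebra_simps)
    moreover have n: "real n + 1 = x - 1" "real n + 2 = x" by (auto simp: x_def)
    moreover have "g n = p * ((2 * x - 1) / (m * (m + p)))"
      using f_Suc[OF x_def] by (simp add: g_def m)
    ultimately show ?thesis using m(2,3) unfolding n by (simp add: power2_eq_square)
  qed
  have "1 / p - 1 - R \<le> p * 1"
  proof (rule sums_le[OF _ g sums_mult[OF telescoping_inverse_square_sums[of 1, simplified]]])
    fix n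
    define m where "m = (real n + 1) * (real n + 2)"
    have "0 < m" by (simp add: m_def)
    then have "m / (m + p) \<le> 1" using p_pos by simp
    moreover have "1 / (real n + 2)\<^sup>2 \<le> 1 / (real n + 1)\<^sup>2"
      by (intro divide_left_mono power_mono) auto
    then have "0 \<le> p * (1 / (real n + 1)\<^sup>2 - 1 / (real n + 2)\<^sup>2)"
      using p_pos by simp
    ultimately show "g n \<le> p * (1 / (real n + 1)\<^sup>2 - 1 / (real n + 2)\<^sup>2)"
      unfolding g_eq[OF m_def] by (rule mult_left_le)
  qed
  then have "p * (1 / p - 1 - R) \<le> p * p" using p_pos by (intro mult_left_mono) auto
  then show "1 - p - p\<^sup>2 \<le> p * R"
    using p_pos by (simp add: right_diff_distrib power2_eq_square)
  \<comment> \<open>The first term is estimated apart. From the second on m >= 6, hence m/(m + p) >=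
    24/25 for p <= 1/4, and 2/3 + 24/25 * 1/4 exceeds 9/10.\<close>
  have "p * (24/25) * (1 / 2\<^sup>2) \<le> 1 / p - 1 - R - g 0"
  proof (rule sums_le[OF _ sums_mult[OF telescoping_inverse_square_sums]])
    show "(\<lambda>n. g (Suc n)) sums (1 / p - 1 - R - g 0)" using g by (simp add: sums_Suc_iff)
    fix n
    define m where "m = (real (Suc n) + 1) * (real (Suc n) + 2)"
    have "6 \<le> m" by (simp add: m_def algebra_simps)
    then have "24/25 \<le> m / (m + p)" using p_pos p_le by (simp add: field_simps)
    moreover have "1 / (real n + 3)\<^sup>2 \<le> 1 / (real n + 2)\<^sup>2"
      by (intro divide_left_mono power_mono) auto
    then have "0 \<le> p * (1 / (real n + 2)\<^sup>2 - 1 / (real n + 3)\<^sup>2)"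
      using p_pos by simp
    ultimately have "p * (1 / (real n + 2)\<^sup>2 - 1 / (real n + 3)\<^sup>2) * (24/25)
        \<le> p * (1 / (real n + 2)\<^sup>2 - 1 / (real n + 3)\<^sup>2) * (m / (m + p))"
      by (rule mult_left_mono)
    then show "p * (24/25) * (1 / (real n + 2)\<^sup>2 - 1 / (real n + (2 + 1))\<^sup>2) \<le> g (Suc n)"
      unfolding g_eq[OF m_def] by (simp add: mult_ac add_ac)
  qed simp
  moreover have "p * (2/3) \<le> g 0"
  proof -
    have "g 0 = p * (3/4 * (2 / (2 + p)))" using g_eq[OF refl, of 0] by simp
    moreover have "8/9 \<le> 2 / (2 + p)" using p_pos p_le by (simp add: field_simps)
    then have "p * (2/3) \<le> p * (3/4 * (2 / (2 + p)))" using p_pos by (intro mult_left_mono) linarith+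
    ultimately show ?thesis by simp
  qed
  ultimately have "p * (9/10) \<le> 1 / p - 1 - R" using p_pos by (simp add: power2_eq_square)
  then have "p * (p * (9/10)) \<le> p * (1 / p - 1 - R)" using p_pos by (intro mult_left_mono) auto
  then show "p * R \<le> 1 - p - 9/10 * p\<^sup>2"
    using p_pos by (simp add: right_diff_distrib power2_eq_square)
qed

text \<open>11/4 is what \<open>R_bounds\<close> gives at p = 1/4; the true value there is 4 log 2 =
  2.77....\<close>

lemma R_ge: "11/4 \<le> R"
proof -
  have "p * (11/4) \<le> 1 - p - p\<^sup>2"
    using p_pos p_le mult_mono[of p "1/4" p "1/4"] by (simp add: power2_eq_square)
  also note R_bounds(1)
  finally show ?thesis using p_pos by simp
qed

text \<open>Makes the lower constant g = t/R - 1 positive.\<close>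

lemma R_less_t: "R < t"
proof -
  have "p * R < p * t"
    using R_bounds t_bounds p_pos zero_less_power[of p 2] by linarith
  then show ?thesis using p_pos by simp
qed

text \<open>Used twice: it gives the upper bound at x = 1, and g < p for g = t/R - 1.\<close>

lemma t_less: "t < (1 + p) * R"
proof -
  have sq: "p\<^sup>2 \<le> p / 4" using p_pos p_le by (simp add: power2_eq_square)
  have "p * t \<le> 1 - p + 3/4 * p\<^sup>2" by (rule t_bounds)
  also have "\<dots> < (1 + p) * (1 - p - p\<^sup>2)"
  proof -
    have "p * p\<^sup>2 \<le> p * (p / 4)" using mult_left_mono[OF sq, of p] p_pos by simp
    then have "p * p\<^sup>2 \<le> p / 16" using sq by (simp add: power2_eq_square)
    moreover have "(1 + p) * (1 - p - p\<^sup>2) - (1 - p + 3/4 * p\<^sup>2) = p - 11/4 * p\<^sup>2 - p * p\<^sup>2"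
      by (simp add: power2_eq_square algebra_simps)
    ultimately show ?thesis using sq p_pos by linarith
  qed
  also have "\<dots> \<le> (1 + p) * (p * R)" using R_bounds p_pos by (intro mult_left_mono) auto
  finally have "p * t < p * ((1 + p) * R)" by (simp only: mult_ac)
  then show ?thesis using p_pos by simp
qed

text \<open>This is h > 0 at x = 1 for g = t/R - 1. Multiplied by p^2 R it compares X^2 with T((1 +
  p)X - p); passing to the second-order remainders r and s exposes the cancellation and leaves a
  factor p^2.\<close>

lemma t_R_inequality: "R < t * (1 + p) - t / R"
proof -
  define X T where "X = p * R" and "T = p * t"
  define r s where "r = (1 - p - X) / p\<^sup>2" and "s = (T - 1 + p) / p\<^sup>2"
  have p2: "p\<^sup>2 > 0" using p_pos by simp
  have X: "X = 1 - p - p\<^sup>2 * r" and T: "T = 1 - p + p\<^sup>2 * s"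
    using p2 by (auto simp: r_def s_def)
  have "p\<^sup>2 * r \<le> p\<^sup>2 * 1" "p\<^sup>2 * (9/10) \<le> p\<^sup>2 * r" "p\<^sup>2 * s \<le> p\<^sup>2 * (3/4)" "p\<^sup>2 * (53/100) \<le> p\<^sup>2 * s"
    using R_bounds t_bounds unfolding X_def[symmetric] T_def[symmetric] X T by linarith+
  then have r: "9/10 \<le> r" "r \<le> 1" and s: "53/100 \<le> s" "s \<le> 3/4" using p2 by simp_all
  have sq: "p\<^sup>2 \<le> 1/16" using power_mono[OF p_le, of 2] p_pos by (simp add: power_divide)
  have X_ge: "11/16 \<le> X"
  proof -
    have "p\<^sup>2 * r \<le> 1/16 * 1" using sq r by (intro mult_mono) auto
    then show ?thesis using X p_le by linarith
  qed
  have "r * (3/4) \<le> r * (1 - p)" using r p_le by (intro mult_left_mono) auto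
  then have "1/5 \<le> s + r - 1 - p * r" using r s by (simp add: algebra_simps)
  then have "11/16 * (1/5) \<le> X * (s + r - 1 - p * r)" using X_ge by (intro mult_mono) auto
  moreover have "p\<^sup>2 * ((s + r) * (1 + p * r)) \<le> 1/16 * (7/4 * (5/4))"
    using sq r s p_pos p_le mult_mono[of p "1/4" r 1] by (intro mult_mono) auto
  \<comment> \<open>The margin is 11/80 = 0.1375 against 35/256 = 0.1367..., so the constants 9/10
    and 53/100 leave little slack.\<close>
  ultimately have *: "p\<^sup>2 * ((s + r) * (1 + p * r)) < X * (s + r - 1 - p * r)" by linarith
  have "T * ((1 + p) * X - p) - X\<^sup>2 = p\<^sup>2 * (X * (s + r - 1 - p * r) - p\<^sup>2 * ((s + r) * (1 + p * r)))"
  proof -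
    have T': "T = X + p\<^sup>2 * (s + r)" using X T by (simp add: algebra_simps)
    have X': "(1 + p) * X - p = X - p\<^sup>2 * (1 + p * r)"
    proof -
      have "p * X = p - p\<^sup>2 - p * (p\<^sup>2 * r)" by (subst X) (simp add: power2_eq_square algebra_simps)
      then show ?thesis by (simp add: algebra_simps)
    qed
    show ?thesis unfolding T' X' by (simp add: power2_eq_square algebra_simps)
  qed
  then have "X\<^sup>2 < T * ((1 + p) * X - p)" using * p2 by (smt (verit) mult_pos_pos)
  then have "p\<^sup>2 * R\<^sup>2 < p\<^sup>2 * (t * ((1 + p) * R - 1))"
    by (simp add: X_def T_def power2_eq_square algebra_simps)
  then have "R\<^sup>2 < t * ((1 + p) * R - 1)" using p2 by simp
  then show ?thesis using R_ge by (simp add: power2_eq_square field_simps)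
qed

end

section \<open>A maximum principle\<close>

text \<open>At the minimum the flux vanishes. Were its derivative negative, the flux and hence v'
  would be negative just to the right, and v would drop below its minimum.\<close>

lemma interior_min_flux_derivative_nonneg:
  fixes v q w :: "real \<Rightarrow> real"
  assumes m: "l < m" "m < r"
    and w: "\<And>x. l < x \<Longrightarrow> x < r \<Longrightarrow> 0 < w x"
    and v: "\<And>x. l < x \<Longrightarrow> x < r \<Longrightarrow> (v has_real_derivative q x / w x) (at x)"
    and q: "(q has_real_derivative D) (at m)"
    and min: "\<And>x. l < x \<Longrightarrow> x < r \<Longrightarrow> v m \<le> v x"
  shows "0 \<le> D"
proof (rule ccontr)
  assume "\<not> 0 \<le> D"
  then have D: "D < 0" by simp
  have "q m / w m = 0"
    by (rule DERIV_local_min[OF v, where d = "Min {m - l, r - m}"]) (use m min in \<open>auto simp: abs_if split: if_splits\<close>)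
  then have qm: "q m = 0" using w[of m] m by auto
  obtain d where d: "d > 0" "\<And>h. 0 < h \<Longrightarrow> h < d \<Longrightarrow> q (m + h) < q m"
    using DERIV_neg_dec_right[OF q D] by blast
  obtain h where h: "0 < h" "h < d" "h < r - m"
    using field_lbound_gt_zero[of d "r - m"] d(1) m by auto
  have "\<exists>z>m. z < m + h \<and> v (m + h) - v m = (m + h - m) * (q z / w z)"
    by (rule MVT2) (use h m in \<open>auto intro!: v\<close>)
  then obtain z where z: "m < z" "z < m + h" "v (m + h) - v m = (m + h - m) * (q z / w z)"
    by blast
  have "q z < 0" using d(2)[of "z - m"] z h qm by simp
  moreover have "w z > 0" using w z h m by simp
  ultimately have "q z / w z < 0" by (simp add: divide_neg_pos)
  then have "h * (q z / w z) < 0" using h by (simp only: mult_pos_neg)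
  then have "v (m + h) < v m" using z(3) by simp
  then show False using min[of "m + h"] h m by simp
qed

lemma tendsto_0_deriv_pos_imp_pos:
  fixes f :: "real \<Rightarrow> real"
  assumes lim: "(f \<longlongrightarrow> 0) (at_right 0)"
    and f: "\<And>x. 0 < x \<Longrightarrow> x < d \<Longrightarrow> (f has_real_derivative f' x) (at x)"
    and pos: "\<And>x. 0 < x \<Longrightarrow> x < d \<Longrightarrow> 0 < f' x"
    and x: "0 < x" "x < d"
  shows "0 < f x"
proof -
  have mono: "f y < f z" if "0 < y" "y < z" "z < d" for y z
  proof (rule DERIV_pos_imp_increasing[OF \<open>y < z\<close>])
    fix u assume "y \<le> u" "u \<le> z"
    then show "\<exists>D. (f has_real_derivative D) (at u) \<and> 0 < D" using that f[of u] pos[of u] by auto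
  qed
  have "0 \<le> f (x / 2)"
  proof (rule tendsto_upperbound[OF lim])
    show "\<forall>\<^sub>F y in at_right 0. f y \<le> f (x / 2)"
      using x by (auto simp: eventually_at_right_field intro!: exI[of _ "x/2"] less_imp_le mono)
  qed simp
  also have "\<dots> < f x" using x by (intro mono) auto
  finally show ?thesis .
qed

text \<open>Abstracted so that one argument serves v for the lower bound and, with all signs
  reversed, -v for the upper one. The singular end 0 enters only through limits.\<close>

locale flux_equation =
  fixes p :: real and v q h :: "real \<Rightarrow> real"
  assumes p_pos: "0 < p"
    and v_deriv: "\<And>x. 0 < x \<Longrightarrow> x < 1 \<Longrightarrow> (v has_real_derivative q x / (x * (1 - x))) (at x)"
    and q_deriv: "\<And>x. 0 < x \<Longrightarrow> x < 1 \<Longrightarrow> (q has_real_derivative p * v x + h x) (at x)"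
    and v_lim: "(v \<longlongrightarrow> 0) (at_right 0)"
    and q_lim: "(q \<longlongrightarrow> 0) (at_right 0)"
    and v_lim_1: "(v \<longlongrightarrow> v 1) (at_left 1)"
    and h_ev: "\<exists>c>0. \<forall>\<^sub>F x in at_right 0. c < h x"
begin

lemma pos_near_0: "\<forall>\<^sub>F x in at_right 0. 0 < v x"
proof -
  obtain c where c: "c > 0" "\<forall>\<^sub>F x in at_right 0. c < h x" using h_ev by blast
  have "((\<lambda>x. p * v x) \<longlongrightarrow> p * 0) (at_right 0)" by (intro tendsto_intros v_lim)
  then have "\<forall>\<^sub>F x in at_right 0. - c < p * v x"
    using c by (intro order_tendstoD(1)[where y = "p * 0"]) auto
  then have "\<forall>\<^sub>F x in at_right 0. 0 < p * v x + h x"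
    using c(2) by eventually_elim simp
  moreover have "\<forall>\<^sub>F x::real in at_right 0. x < 1"
    by (auto simp: eventually_at_right_field intro!: exI[of _ 1])
  ultimately have "\<forall>\<^sub>F x in at_right 0. 0 < p * v x + h x \<and> x < 1"
    by eventually_elim simp
  then obtain d where d: "d > 0" "\<And>x. 0 < x \<Longrightarrow> x < d \<Longrightarrow> 0 < p * v x + h x \<and> x < 1"
    by (auto simp: eventually_at_right_field)
  have "0 < q x" if "0 < x" "x < d" for x
    by (rule tendsto_0_deriv_pos_imp_pos[OF q_lim q_deriv _ that]) (use d in auto)
  then have "0 < v x" if "0 < x" "x < d" for x
    by (intro tendsto_0_deriv_pos_imp_pos[OF v_lim v_deriv _ that])
       (use d in \<open>auto intro!: divide_pos_pos mult_pos_pos\<close>)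
  then show ?thesis using d(1) by (auto simp: eventually_at_right_field)
qed

text \<open>At a positive interior maximum q' = p v + h would be positive, against the preceding
  sign condition applied to -v. \<open>V\<close> is v with its end values filled in, since at 0 only
  the limit of v is known.\<close>

lemma no_positive_max:
  assumes lr: "0 \<le> l" "l < z" "z < r" "r \<le> 1"
    and h: "\<And>x. l < x \<Longrightarrow> x < r \<Longrightarrow> 0 \<le> h x"
    and cont: "continuous_on {l..r} V" and V: "\<And>x. l < x \<Longrightarrow> x < r \<Longrightarrow> V x = v x"
    and bd: "V l \<le> 0" "V r \<le> 0"
  shows "v z \<le> 0"
proof (rule ccontr)
  assume "\<not> v z \<le> 0"
  then have z: "V z > 0" using V lr by simp
  obtain M where M: "M \<in> {l..r}" "\<And>x. x \<in> {l..r} \<Longrightarrow> V x \<le> V M"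
    using continuous_attains_sup[OF _ _ cont] lr by fastforce
  have VM: "V M > 0" using M(2)[of z] z lr by simp
  then have Mlr: "l < M" "M < r" using M(1) bd by (auto simp: order_less_le)
  have "0 \<le> - (p * v M + h M)"
  proof (rule interior_min_flux_derivative_nonneg[OF Mlr, of "\<lambda>x. x * (1 - x)" "\<lambda>x. - v x" "\<lambda>x. - q x"])
    show "0 < x * (1 - x)" if "l < x" "x < r" for x using that lr by simp
    show "((\<lambda>x. - v x) has_real_derivative - q x / (x * (1 - x))) (at x)" if "l < x" "x < r" for x
      using DERIV_minus[OF v_deriv[of x]] that lr by simp
    show "((\<lambda>x. - q x) has_real_derivative - (p * v M + h M)) (at M)"
      using Mlr lr by (intro DERIV_minus q_deriv) auto
    show "- v M \<le> - v x" if "l < x" "x < r" for x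
      using M(2)[of x] V[of x] V[of M] Mlr that by simp
  qed
  moreover have "0 < p * v M" using p_pos VM V[OF Mlr] by simp
  ultimately show False using h[OF Mlr] by simp
qed

text \<open>If v is somewhere nonpositive, it has a nonpositive minimum m, where q' >= 0 forces
  \<open>h m\<close> to be nonnegative. It then suffices that h >= 0 on one side of m: there v has
  no positive maximum, so it stays nonpositive, against its positivity near that end.\<close>

theorem positive:
  assumes v1: "0 \<le> v 1"
    and h: "\<And>m. 0 < m \<Longrightarrow> m < 1 \<Longrightarrow> 0 \<le> h m \<Longrightarrow> (\<forall>x. 0 < x \<and> x < m \<longrightarrow> 0 \<le> h x) \<or>
      v 1 = 0 \<and> (\<forall>\<^sub>F x in at_left 1. 0 < v x) \<and> (\<forall>x. m < x \<and> x < 1 \<longrightarrow> 0 \<le> h x)"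
    and z: "0 < z" "z < 1"
  shows "0 < v z"
proof (rule ccontr)
  assume nz: "\<not> 0 < v z"
  define V where "V x = (if x \<le> 0 then 0 else v x)" for x
  have cont: "continuous_on {0..1} V"
  proof (rule continuous_on_IccI)
    have "(V \<longlongrightarrow> 0) (at_right 0)"
      by (rule Lim_transform_eventually[OF v_lim])
         (auto simp: V_def eventually_at_right_field intro!: exI[of _ 1])
    then show "(V \<longlongrightarrow> V 0) (at_right 0)" by (simp add: V_def)
    have "(V \<longlongrightarrow> v 1) (at_left 1)"
      by (rule Lim_transform_eventually[OF v_lim_1])
         (auto simp: V_def eventually_at_left_field intro!: exI[of _ 0])
    then show "(V \<longlongrightarrow> V 1) (at_left 1)" by (simp add: V_def)
    show "(V \<longlongrightarrow> V x) (at x)" if "0 < x" "x < 1" for x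
    proof -
      have "(v \<longlongrightarrow> v x) (at x)" using DERIV_isCont[OF v_deriv[OF that]] by (simp add: isCont_def)
      moreover have "\<forall>\<^sub>F y in at x. v y = V y"
        using order_tendstoD(1)[OF tendsto_ident_at, of 0 x UNIV] that by (auto simp: V_def elim!: eventually_mono)
      ultimately have "(V \<longlongrightarrow> v x) (at x)" by (rule Lim_transform_eventually)
      then show ?thesis using that by (simp add: V_def)
    qed
  qed simp
  obtain m0 where m0: "m0 \<in> {0..1}" "\<And>x. x \<in> {0..1} \<Longrightarrow> V m0 \<le> V x"
    using continuous_attains_inf[OF _ _ cont] by fastforce
  have Vz: "V z \<le> 0" using nz z by (simp add: V_def)
  \<comment> \<open>If the minimum of \<open>V\<close> sits at an end, its value is nonnegative, so
    z itself is an interior minimum.\<close>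
  obtain m where m: "0 < m" "m < 1" "v m \<le> 0" "\<And>x. 0 < x \<Longrightarrow> x < 1 \<Longrightarrow> v m \<le> v x"
  proof (cases "0 < m0 \<and> m0 < 1")
    case True
    show ?thesis
    proof (rule that[of m0])
      show "v m0 \<le> 0" using m0(2)[of z] Vz z True by (simp add: V_def)
      show "v m0 \<le> v x" if "0 < x" "x < 1" for x using m0(2)[of x] that True by (simp add: V_def)
    qed (use True in auto)
  next
    case False
    then have "0 \<le> V m0" using m0(1) v1 by (auto simp: V_def)
    show ?thesis
    proof (rule that[of z])
      show "v z \<le> v x" if "0 < x" "x < 1" for x
        using m0(2)[of x] that \<open>0 \<le> V m0\<close> Vz z by (simp add: V_def)
    qed (use z nz in auto)
  qed
  have "0 \<le> p * v m + h m"
    by (rule interior_min_flux_derivative_nonneg[OF m(1,2) _ v_deriv q_deriv[OF m(1,2)] m(4)]) auto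
  moreover have "p * v m \<le> 0" using p_pos m(3) by (simp add: mult_le_0_iff)
  ultimately have "0 \<le> h m" by simp
  have right: False if *: "\<forall>x. m < x \<and> x < 1 \<longrightarrow> 0 \<le> h x" "v 1 = 0" "\<forall>\<^sub>F x in at_left 1. 0 < v x"
  proof -
    have le: "v x \<le> 0" if "m < x" "x < 1" for x
      by (rule no_positive_max[of m x 1 V, OF _ _ _ _ _ continuous_on_subset[OF cont]])
         (use * m that in \<open>auto simp: V_def\<close>)
    have "\<forall>\<^sub>F x in at_left 1. v x \<le> 0"
      using le m by (auto simp: eventually_at_left_field)
    then have "\<forall>\<^sub>F x in at_left (1::real). False" using *(3) by eventually_elim simp
    then show False by simp
  qed
  have left: False if *: "\<forall>x. 0 < x \<and> x < m \<longrightarrow> 0 \<le> h x"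
  proof -
    have le: "v x \<le> 0" if "0 < x" "x < m" for x
      by (rule no_positive_max[of 0 x m V, OF _ _ _ _ _ continuous_on_subset[OF cont]])
         (use * m that in \<open>auto simp: V_def\<close>)
    have "\<forall>\<^sub>F x in at_right 0. v x \<le> 0"
      using le m by (auto simp: eventually_at_right_field)
    then have "\<forall>\<^sub>F x in at_right (0::real). False" using pos_near_0 by eventually_elim simp
    then show False by simp
  qed
  show False
    using h[OF m(1,2) \<open>0 \<le> h m\<close>] by (rule disjE) (rule left, assumption, rule right, blast+)
qed

text \<open>At 1 the quotient q/(x(1-x)) has the form 0/0, so the sign is read off the slope of q: q
  is negative to the left of 1, hence v decreases to 0.\<close>

lemma pos_near_1:
  assumes v1: "v 1 = 0" and q1: "q 1 = 0" and D: "(q has_real_derivative D) (at 1)" "0 < D"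
  shows "\<forall>\<^sub>F x in at_left 1. 0 < v x"
proof -
  obtain d where d: "d > 0" "\<And>y. 0 < y \<Longrightarrow> y < d \<Longrightarrow> q (1 - y) < q 1"
    using DERIV_pos_inc_left[OF D] by blast
  have "0 < v x" if x: "max 0 (1 - d) < x" "x < 1" for x
  proof -
    have "v 1 < v x"
    proof (rule DERIV_neg_imp_decreasing_open[OF x(2)])
      fix y assume y: "x < y" "y < 1"
      then have "q y < 0" using d(2)[of "1 - y"] x q1 by simp
      then show "\<exists>D. (v has_real_derivative D) (at y) \<and> D < 0"
        using v_deriv[of y] x y by (intro exI[of _ "q y / (y * (1 - y))"]) (auto intro!: divide_neg_pos)
    next
      show "continuous_on {x..1} v"
        using x v_lim_1 DERIV_isCont[OF v_deriv]
        by (intro continuous_on_IccI) (auto simp: isCont_def intro: tendsto_within_subset)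
    qed
    then show ?thesis using v1 by simp
  qed
  moreover have "max 0 (1 - d) < 1" using d(1) by simp
  ultimately show ?thesis unfolding eventually_at_left_field by blast
qed

end

section \<open>The hypergeometric equation\<close>

text \<open>Absolute summability lets the M-test on the closed interval do the work of Abel's limit
  theorem.\<close>

lemma abs_summable_powser_at_left_1:
  fixes c :: "nat \<Rightarrow> real"
  assumes "summable (\<lambda>n. \<bar>c n\<bar>)"
  shows "((\<lambda>z. \<Sum>n. c n * z ^ n) \<longlongrightarrow> (\<Sum>n. c n)) (at_left 1)"
proof -
  have "uniform_limit {0..1} (\<lambda>N z. \<Sum>n<N. c n * z ^ n) (\<lambda>z. \<Sum>n. c n * z ^ n) sequentially"
    using assms by (rule Weierstrass_m_test[rotated])
      (auto simp: abs_mult power_abs intro!: mult_left_le power_le_one)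
  then have "continuous_on {0..1} (\<lambda>z. \<Sum>n. c n * z ^ n)"
    by (rule uniform_limit_theorem[rotated]) (auto intro!: always_eventually continuous_intros)
  then show ?thesis using continuous_on_Icc_at_leftD[of 0 1] by fastforce
qed

lemma filterlim_one_minus_at_right_0: "filterlim (\<lambda>x::real. 1 - x) (at_left 1) (at_right 0)"
  by real_asymp

context elliptic_parameter begin

lemma d_sums_bound: "\<bar>z\<bar> < 1 \<Longrightarrow> summable (\<lambda>n. d n * z ^ n)"
proof (rule summable_comparison_test_ev[where g = "\<lambda>n. (t + 1) * \<bar>z\<bar> ^ n"])
  show "\<forall>\<^sub>F n in sequentially. norm (d n * z ^ n) \<le> (t + 1) * \<bar>z\<bar> ^ n"
  proof (intro always_eventually allI)
    fix n
    have "d n \<le> t + 1"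
    proof (cases n)
      case (Suc m)
      have "1 * d (Suc m) \<le> u m" unfolding u_def using d_pos[of "Suc m"] by (intro mult_right_mono) auto
      then show ?thesis using u_le[of m] t_pos Suc by simp
    qed (simp add: d_0)
    then show "norm (d n * z ^ n) \<le> (t + 1) * \<bar>z\<bar> ^ n"
      using d_pos[of n] by (auto simp: abs_mult power_abs intro!: mult_right_mono)
  qed
qed (auto intro!: summable_mult summable_geometric)

text \<open>These are the coefficients of z(1-z) dY/dz in z = 1 - x. In this form the differentiated
  series visibly has coefficients \<open>p * d n\<close>, which is the hypergeometric equation;
  \<open>w_Suc\<close> is the form that comes from multiplying out.\<close>

definition w :: "nat \<Rightarrow> real" where
  "w n = (if n = 0 then 0 else p * d (n - 1) / real n)"

lemma w_Suc: "w (Suc n) = Suc n * d (Suc n) - n * d n"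
proof -
  define m where "m = real n + 1"
  have m: "m > 0" by (simp add: m_def)
  have "m * (((m - 1) * m + p) / m\<^sup>2 * d n) = (m - 1) * d n + p * d n / m"
    using m by (simp add: power2_eq_square field_simps)
  then show ?thesis by (simp add: w_def d_Suc m_def add_ac)
qed

lemma w_nonneg: "0 \<le> w n"
  using d_pos[of "n - 1"] p_pos by (simp add: w_def)

text \<open>By \<open>w_Suc\<close> the series telescopes to the limit of \<open>n * d n\<close>.
  This is the source of the flux limit -1 at x = 0.\<close>

lemma w_sums: "w sums 1"
proof -
  have "(\<lambda>n. n * d n) \<longlonglongrightarrow> 1"
    using u_limit unfolding u_def by (rule LIMSEQ_imp_Suc)
  from telescope_sums[OF this] have "(\<lambda>n. w (Suc n)) sums 1" by (simp add: w_Suc)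
  then have "w sums (1 + w 0)" by (rule sums_Suc)
  then show ?thesis by (simp add: w_def)
qed

text \<open>\<open>qY\<close> is the flux \<open>x(1-x)Y'\<close>, see \<open>Y_deriv\<close>; its series makes the value at \<open>0\<close> accessible.\<close>

definition Y :: "real \<Rightarrow> real" where "Y x = (\<Sum>n. d n * (1 - x) ^ n)"
definition qY :: "real \<Rightarrow> real" where "qY x = - (\<Sum>n. w n * (1 - x) ^ n)"

lemma w_summable: "\<bar>z\<bar> < 1 \<Longrightarrow> summable (\<lambda>n. w n * z ^ n)"
  using powser_inside[of w 1 z] w_sums by (simp add: sums_iff)

text \<open>The series in 1 - x converges for 0 < x < 2, so x = 1 is an interior point. The product
  form of the second claim stays meaningful there, where division by x(1-x) would not.\<close>

lemma Y_deriv: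
  assumes x: "0 < x" "x < 2"
  obtains D where "(Y has_real_derivative D) (at x)" "qY x = x * (1 - x) * D"
proof
  define z where "z = 1 - x"
  have z: "\<bar>z\<bar> < 1" using x by (auto simp: z_def)
  have m1: "((\<lambda>x. 1 - x) has_real_derivative - 1) (at x)" by (auto intro!: derivative_eq_intros)
  define U where "U = (\<Sum>n. diffs d n * z ^ n)"
  have "((\<lambda>z. \<Sum>n. d n * z ^ n) has_real_derivative U) (at (1 - x))"
    unfolding U_def z_def[symmetric] using d_sums_bound z by (intro termdiffs_strong'[where K = 1]) auto
  from DERIV_chain2[of "\<lambda>z. \<Sum>n. d n * z ^ n" U "\<lambda>x. 1 - x" x "-1" UNIV, OF this m1]
  show "(Y has_real_derivative - U) (at x)"
    by (simp add: Y_def[abs_def])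
  have "summable (\<lambda>n. diffs d n * z ^ n)"
    using termdiff_converges[of z 1 d] d_sums_bound z by auto
  then have U: "(\<lambda>n. diffs d n * z ^ n) sums U" by (simp add: U_def summable_sums)
  have 1: "(\<lambda>n. Suc n * d (Suc n) * z ^ Suc n) sums (z * U)"
    using sums_mult[OF U, of z] by (simp add: diffs_def mult_ac)
  then have "(\<lambda>n. n * d n * z ^ n) sums (z * U)"
    using sums_Suc_iff[of "\<lambda>n. n * d n * z ^ n" "z * U"] by simp
  from sums_mult[OF this, of z] have 2: "(\<lambda>n. n * d n * z ^ Suc n) sums (z * (z * U))"
    by (simp add: mult_ac)
  have "(\<lambda>n. w (Suc n) * z ^ Suc n) sums (z * U - z * (z * U))"
    using sums_diff[OF 1 2] by (simp only: w_Suc left_diff_distrib)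
  then have "(\<lambda>n. w n * z ^ n) sums (z * U - z * (z * U))"
    using sums_Suc_iff[of "\<lambda>n. w n * z ^ n" "z * U - z * (z * U)"] by (simp add: w_def)
  then have "qY x = - (z * U - z * (z * U))" by (simp add: qY_def z_def sums_iff)
  then show "qY x = x * (1 - x) * (- U)" by (simp add: z_def algebra_simps)
qed

lemma qY_deriv:
  assumes x: "0 < x" "x < 2"
  shows "(qY has_real_derivative p * Y x) (at x)"
proof -
  define z where "z = 1 - x"
  have z: "\<bar>z\<bar> < 1" using x by (auto simp: z_def)
  have m1: "((\<lambda>x. 1 - x) has_real_derivative - 1) (at x)" by (auto intro!: derivative_eq_intros)
  have "diffs w n = p * d n" for n by (simp add: diffs_def w_def)
  then have "(\<Sum>n. diffs w n * z ^ n) = p * Y x"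
    using suminf_mult[OF d_sums_bound[OF z], of p] by (simp add: Y_def z_def mult_ac)
  moreover have "((\<lambda>z. \<Sum>n. w n * z ^ n) has_real_derivative (\<Sum>n. diffs w n * z ^ n)) (at (1 - x))"
    unfolding z_def[symmetric] using w_summable z by (intro termdiffs_strong'[where K = 1]) auto
  ultimately have *: "((\<lambda>z. \<Sum>n. w n * z ^ n) has_real_derivative p * Y x) (at (1 - x))" by simp
  from DERIV_chain2[of "\<lambda>z. \<Sum>n. w n * z ^ n" _ "\<lambda>x. 1 - x" x "-1" UNIV, OF this m1]
  have "((\<lambda>x. \<Sum>n. w n * (1 - x) ^ n) has_real_derivative - (p * Y x)) (at x)"
    by simp
  from DERIV_minus[OF this] show ?thesis by (simp add: qY_def[abs_def])
qed

lemma qY_1: "qY 1 = 0" by (simp add: qY_def w_def)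

lemma Y_1: "Y 1 = t" by (simp add: Y_def d_0)

lemma qY_limit: "(qY \<longlongrightarrow> - 1) (at_right 0)"
proof -
  have "summable (\<lambda>n. \<bar>w n\<bar>)" "(\<Sum>n. w n) = 1" using w_sums w_nonneg by (auto simp: sums_iff)
  with abs_summable_powser_at_left_1[of w]
  have "((\<lambda>z. \<Sum>n. w n * z ^ n) \<longlongrightarrow> 1) (at_left 1)" by simp
  from tendsto_minus[OF filterlim_compose[OF this filterlim_one_minus_at_right_0]]
  show ?thesis by (simp add: qY_def[abs_def])
qed

text \<open>Adding the logarithm removes the part 1/n of the coefficients; what is left is
  absolutely summable, so x can tend to 0 inside the series.\<close>

lemma Y_plus_ln:
  assumes x: "0 < x" "x < 2"
  shows "Y x + ln x = (\<Sum>n. e n * (1 - x) ^ n)"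
proof -
  define z where "z = 1 - x"
  have z: "\<bar>z\<bar> < 1" using x by (auto simp: z_def)
  have "(\<lambda>n. - ((- (- z)) ^ n) / n) sums ln (1 + - z)"
    using z by (intro ln_series') simp
  then have "(\<lambda>n. - (z ^ n / n)) sums ln x" by (simp add: z_def)
  moreover have "(\<lambda>n. d n * z ^ n) sums Y x"
    using d_sums_bound[OF z] by (simp add: Y_def z_def summable_sums)
  ultimately have "(\<lambda>n. d n * z ^ n + - (z ^ n / n)) sums (Y x + ln x)" by (intro sums_add)
  moreover have "d n * z ^ n + - (z ^ n / n) = e n * z ^ n" for n
    by (simp add: e_def left_diff_distrib)
  ultimately show ?thesis by (simp add: sums_iff z_def)
qed

lemma Y_limit: "((\<lambda>x. Y x + ln x) \<longlongrightarrow> R) (at_right 0)"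
proof -
  have "((\<lambda>z. \<Sum>n. e n * z ^ n) \<longlongrightarrow> R) (at_left 1)"
    using abs_summable_powser_at_left_1[OF summable_abs_e] e_sums by (simp add: sums_iff)
  from filterlim_compose[OF this filterlim_one_minus_at_right_0]
  have "((\<lambda>x. \<Sum>n. e n * (1 - x) ^ n) \<longlongrightarrow> R) (at_right 0)" .
  then show ?thesis
    by (rule Lim_transform_eventually)
       (auto simp: eventually_at_right_field Y_plus_ln intro!: exI[of _ 1])
qed

end

section \<open>Sharp bounds\<close>

text \<open>The derivative of this function has the sign of the concave quadratic \<open>N\<close> below.\<close>

lemma ln_minus_moebius_sign_pattern:
  fixes A B C E R :: real
  defines "k \<equiv> \<lambda>x. R - ln x - (C + E * x) / (A + B * x)"
  assumes A: "0 < A" and B: "0 < B"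
    and xs: "0 < x" "x < m" "m < y" "y < 1"
    and k: "k x < 0" "0 \<le> k m" "k y < 0" "0 < k 1"
  shows False
proof -
  define N where "N x = (C * B - E * A) * x - (A + B * x)\<^sup>2" for x
  have pos: "0 < A + B * x" if "0 < x" for x using A B that by (simp add: add_pos_pos)
  have k': "(k has_real_derivative N x / (x * (A + B * x)\<^sup>2)) (at x)" if "0 < x" for x
  proof -
    have P: "A + B * x \<noteq> 0" using pos[OF that] by simp
    have "(k has_real_derivative - (1 / x) - (E * (A + B * x) - (C + E * x) * B) / ((A + B * x) * (A + B * x))) (at x)"
      unfolding k_def using that P by (auto intro!: derivative_eq_intros)
    moreover have "- (1 / x) - (E * (A + B * x) - (C + E * x) * B) / ((A + B * x) * (A + B * x))
        = N x / (x * (A + B * x)\<^sup>2)"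
      unfolding N_def power2_eq_square using P that
      by (simp add: divide_simps) (simp add: algebra_simps)
    ultimately show ?thesis by simp
  qed
  have mvt: "\<exists>z. l < z \<and> z < r \<and> k r - k l = (r - l) * (N z / (z * (A + B * z)\<^sup>2))"
    if "0 < l" "l < r" for l r
    using MVT2[of l r k "\<lambda>z. N z / (z * (A + B * z)\<^sup>2)"] k' that by force
  have den: "0 < z * (A + B * z)\<^sup>2" if "0 < z" for z
    using that pos[OF that] by simp
  \<comment> \<open>From x to m to y to 1 the function k rises, falls and rises, so N is positive,
    negative and positive at three successive points.\<close>
  obtain z1 where z1: "x < z1" "z1 < m" "k m - k x = (m - x) * (N z1 / (z1 * (A + B * z1)\<^sup>2))"
    using mvt[of x m] xs by auto
  obtain z2 where z2: "m < z2" "z2 < y" "k y - k m = (y - m) * (N z2 / (z2 * (A + B * z2)\<^sup>2))"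
    using mvt[of m y] xs by auto
  obtain z3 where z3: "y < z3" "z3 < 1" "k 1 - k y = (1 - y) * (N z3 / (z3 * (A + B * z3)\<^sup>2))"
    using mvt[of y 1] xs by auto
  have N_pos: "0 < N z" if "0 < c" "0 < z" "0 < c * (N z / (z * (A + B * z)\<^sup>2))" for c z
  proof (rule ccontr)
    assume "\<not> 0 < N z"
    then have "c * (N z / (z * (A + B * z)\<^sup>2)) \<le> 0"
      using den[of z] that by (intro mult_nonneg_nonpos divide_nonpos_pos) auto
    with that show False by simp
  qed
  have N_neg: "N z < 0" if "0 < c" "0 < z" "c * (N z / (z * (A + B * z)\<^sup>2)) < 0" for c z
  proof (rule ccontr)
    assume "\<not> N z < 0"
    then have "0 \<le> c * (N z / (z * (A + B * z)\<^sup>2))"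
      using den[of z] that by (intro mult_nonneg_nonneg divide_nonneg_pos) auto
    with that show False by simp
  qed
  have N1: "0 < N z1" by (rule N_pos[of "m - x"]) (use z1 xs k in linarith)+
  have N2: "N z2 < 0" by (rule N_neg[of "y - m"]) (use z2 xs k in linarith)+
  have N3: "0 < N z3" by (rule N_pos[of "1 - y"]) (use z3 xs k in linarith)+
  \<comment> \<open>N has leading coefficient -B^2, so at z2 it lies above its chord from z1 to z3
    by B^2 (z3 - z2)(z2 - z1).\<close>
  have "N z2 * (z3 - z1) = N z1 * (z3 - z2) + N z3 * (z2 - z1)
      + B\<^sup>2 * ((z3 - z2) * (z2 - z1) * (z3 - z1))"
    unfolding N_def by (simp add: power2_eq_square algebra_simps)
  moreover have "0 < N z1 * (z3 - z2)" "0 < N z3 * (z2 - z1)"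
      "0 \<le> B\<^sup>2 * ((z3 - z2) * (z2 - z1) * (z3 - z1))" "N z2 * (z3 - z1) < 0"
    using N1 N2 N3 z1 z2 z3 by (auto intro!: mult_pos_pos mult_nonneg_nonneg mult_neg_pos)
  ultimately show False by linarith
qed

context elliptic_parameter begin

definition v :: "real \<Rightarrow> real \<Rightarrow> real" where
  "v g x = Y x - (R - ln x) * (1 + g * x)"

definition q :: "real \<Rightarrow> real \<Rightarrow> real" where
  "q g x = qY x - (1 - x) * (g * x * (R - ln x) - (1 + g * x))"

text \<open>What is left of q' once p v is removed; Y cancels by the hypergeometric
  equation.\<close>

definition h :: "real \<Rightarrow> real \<Rightarrow> real" where
  "h g x = (R - ln x) * (p - g + (2 + p) * g * x) - (1 - 2 * g + 3 * g * x)"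

lemma v_deriv:
  assumes x: "0 < x" "x < 1"
  shows "(v g has_real_derivative q g x / (x * (1 - x))) (at x)"
proof -
  obtain D where D: "(Y has_real_derivative D) (at x)" "qY x = x * (1 - x) * D"
    using Y_deriv x by (metis less_trans one_less_numeral_iff semiring_norm(76))
  have "(v g has_real_derivative D - (g * (R - ln x) - (1 + g * x) / x)) (at x)"
    unfolding v_def using x by (auto intro!: derivative_eq_intros D(1))
  moreover have "D - (g * (R - ln x) - (1 + g * x) / x) = q g x / (x * (1 - x))"
  proof -
    define W where "W = g * (R - ln x) - (1 + g * x) / x"
    have "x * W = g * x * (R - ln x) - (1 + g * x)"
      using x by (simp add: W_def right_diff_distrib)
    then have "q g x = x * (1 - x) * D - (1 - x) * (x * W)" by (simp only: q_def D(2))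
    then have "q g x = x * (1 - x) * (D - W)" by (simp add: right_diff_distrib left_diff_distrib mult_ac)
    then have "q g x = x * (1 - x) * (D - (g * (R - ln x) - (1 + g * x) / x))" by (simp only: W_def)
    then show ?thesis using x by simp
  qed
  ultimately show ?thesis by simp
qed

lemma q_deriv:
  assumes x: "0 < x" "x < 2"
  shows "(q g has_real_derivative p * v g x + h g x) (at x)"
proof -
  have "(q g has_real_derivative p * Y x -
      (- (g * x * (R - ln x) - (1 + g * x)) + (1 - x) * (g * (R - ln x) - g - g))) (at x)"
    unfolding q_def using x by (auto intro!: derivative_eq_intros qY_deriv)
  moreover have "p * Y x - (- (g * x * (R - ln x) - (1 + g * x)) + (1 - x) * (g * (R - ln x) - g - g))
      = p * v g x + h g x"
    by (simp add: v_def h_def algebra_simps)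
  ultimately show ?thesis by simp
qed

lemma v_limit: "(v g \<longlongrightarrow> 0) (at_right 0)"
proof -
  have "((\<lambda>x. g * x * (R - ln x)) \<longlongrightarrow> 0) (at_right 0)" by real_asymp
  from tendsto_diff[OF tendsto_diff[OF Y_limit tendsto_const[of R]] this]
  show ?thesis by (simp add: v_def[abs_def] algebra_simps)
qed

lemma q_limit: "(q g \<longlongrightarrow> 0) (at_right 0)"
proof -
  have "((\<lambda>x. (1 - x) * (g * x * (R - ln x) - (1 + g * x))) \<longlongrightarrow> - 1) (at_right 0)" by real_asymp
  from tendsto_diff[OF qY_limit this] show ?thesis by (simp add: q_def[abs_def])
qed

lemma v_limit_1: "(v g \<longlongrightarrow> v g 1) (at_left 1)"
proof -
  obtain D where D: "(Y has_real_derivative D) (at 1)" using Y_deriv[of 1] by auto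
  have "isCont (v g) 1"
    unfolding v_def by (auto intro!: continuous_intros DERIV_isCont[OF D])
  then show ?thesis by (simp add: isCont_def filterlim_at_split)
qed

text \<open>At x = 0 the logarithm in h carries the factor p - g; this is where p comes in as the
  critical constant.\<close>

lemma h_limit: "g < p \<Longrightarrow> filterlim (h g) at_top (at_right 0)"
  unfolding h_def by real_asymp

lemma flux: "g < p \<Longrightarrow> flux_equation p (v g) (q g) (h g)"
  using filterlim_at_top_dense[THEN iffD1, OF h_limit, of g]
  by unfold_locales
    (auto intro: p_pos v_deriv q_deriv v_limit q_limit v_limit_1 exI[of _ 1])

lemma flux_minus: "flux_equation p (\<lambda>x. - v p x) (\<lambda>x. - q p x) (\<lambda>x. - h p x)"
proof
  show "((\<lambda>x. - v p x) has_real_derivative - q p x / (x * (1 - x))) (at x)" if "0 < x" "x < 1" for x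
    using DERIV_minus[OF v_deriv[OF that]] by simp
  show "((\<lambda>x. - q p x) has_real_derivative p * - v p x + - h p x) (at x)" if "0 < x" "x < 1" for x
    using DERIV_minus[OF q_deriv, of x p] that by simp
  show "((\<lambda>x. - v p x) \<longlongrightarrow> 0) (at_right 0)" "((\<lambda>x. - q p x) \<longlongrightarrow> 0) (at_right 0)"
    using tendsto_minus[OF v_limit] tendsto_minus[OF q_limit] by simp_all
  show "((\<lambda>x. - v p x) \<longlongrightarrow> - v p 1) (at_left 1)" by (intro tendsto_minus v_limit_1)
  \<comment> \<open>For g = p the logarithm survives only with a factor x, so h has a finite limit;
    1 - 2p >= 1/2 makes it negative.\<close>
  have "((\<lambda>x. - h p x) \<longlongrightarrow> 1 - 2 * p) (at_right 0)" unfolding h_def by real_asymp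
  then have "\<forall>\<^sub>F x in at_right 0. 1/4 < - h p x"
    using p_le by (intro order_tendstoD) auto
  then show "\<exists>c>0. \<forall>\<^sub>F x in at_right 0. c < - h p x" by (intro exI[of _ "1/4"]) simp
qed (rule p_pos)

lemma upper_bound:
  assumes x: "0 < x" "x < 1"
  shows "Y x < (R - ln x) * (1 + p * x)"
proof -
  interpret f: flux_equation p "\<lambda>x. - v p x" "\<lambda>x. - q p x" "\<lambda>x. - h p x" by (rule flux_minus)
  have "0 < - v p x"
  proof (rule f.positive[OF _ _ x])
    show "0 \<le> - v p 1" using t_less by (simp add: v_def Y_1 mult.commute)
    fix m :: real assume m: "0 < m" "m < 1" "0 \<le> - h p m"
    \<comment> \<open>-h is decreasing because R - 1 >= 7/4 and 2 * 7/4 > 3. Hence a nonnegative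
      value at m propagates to the left, and the first alternative of \<open>f.positive\<close>
      always applies.\<close>
    have "- h p m \<le> - h p x" if "0 < x" "x < m" for x
    proof (rule DERIV_nonpos_imp_nonincreasing[where f = "\<lambda>x. - h p x"])
      fix y assume y: "x \<le> y" "y \<le> m"
      have "((\<lambda>x. - h p x) has_real_derivative p * (3 - (2 + p) * (R - ln y - 1))) (at y)"
        unfolding h_def using y that by (auto intro!: derivative_eq_intros simp: field_simps)
      moreover have "p * (3 - (2 + p) * (R - ln y - 1)) \<le> 0"
      proof -
        have "ln y \<le> 0" using y m that by simp
        then have "2 * (7/4) \<le> (2 + p) * (R - ln y - 1)"
          using R_ge p_pos by (intro mult_mono) auto
        then show ?thesis using p_pos by (simp add: mult_le_0_iff)
      qed
      ultimately show "\<exists>D. ((\<lambda>x. - h p x) has_real_derivative D) (at y) \<and> D \<le> 0" by blast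
    qed (use that in simp)
    then show "(\<forall>x. 0 < x \<and> x < m \<longrightarrow> 0 \<le> - h p x) \<or>
      - v p 1 = 0 \<and> (\<forall>\<^sub>F x in at_left 1. 0 < - v p x) \<and> (\<forall>x. m < x \<and> x < 1 \<longrightarrow> 0 \<le> - h p x)"
      using m(3) by force
  qed
  then show ?thesis by (simp add: v_def)
qed

lemma lower_bound:
  assumes x: "0 < x" "x < 1"
  shows "(R - ln x) * (1 + (t / R - 1) * x) < Y x"
proof -
  define g where "g = t / R - 1"
  have g: "0 < g" "g < p" using R_less_t t_less R_ge by (auto simp: g_def field_simps)
  interpret f: flux_equation p "v g" "q g" "h g" using g by (intro flux)
  have v1: "v g 1 = 0" using R_ge by (simp add: v_def Y_1 g_def)
  have h1: "0 < h g 1"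
  proof -
    have "h g 1 = t * (1 + p) - t / R - R"
      using R_ge by (simp add: h_def g_def field_simps)
    then show ?thesis using t_R_inequality by simp
  qed
  \<comment> \<open>The term p v drops out of q' at 1 because v vanishes there.\<close>
  have "(q g has_real_derivative h g 1) (at 1)" using q_deriv[of 1 g] v1 by simp
  then have near_1: "\<forall>\<^sub>F x in at_left 1. 0 < v g x"
    using h1 by (intro f.pos_near_1 v1) (simp_all add: q_def qY_1)
  have "0 < v g x"
  proof (rule f.positive[OF _ _ x])
    fix m :: real assume m: "0 < m" "m < 1" "0 \<le> h g m"
    \<comment> \<open>Dividing h by the positive coefficient of R - ln x isolates the logarithm
      against a Moebius function. Negative values of h on both sides of m would give k the signs -,
      +, -, + at x, m, y, 1, which is impossible.\<close>
    define k where "k x = R - ln x - ((1 - 2 * g) + 3 * g * x) / ((p - g) + (2 + p) * g * x)" for x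
    have pos: "0 < (p - g) + (2 + p) * g * x" if "0 < x" for x
      using g p_pos that by (simp add: add_pos_pos)
    have hk: "h g x = ((p - g) + (2 + p) * g * x) * k x" if "0 < x" for x
      using pos[OF that] by (simp add: h_def k_def right_diff_distrib) (simp add: algebra_simps)
    have "False" if "0 < x" "x < m" "h g x < 0" "m < y" "y < 1" "h g y < 0" for x y
    proof (rule ln_minus_moebius_sign_pattern[where A = "p - g" and B = "(2 + p) * g" and x = x and m = m and y = y
          and R = R and C = "1 - 2 * g" and E = "3 * g"])
      show "R - ln x - (1 - 2 * g + 3 * g * x) / (p - g + (2 + p) * g * x) < 0"
        using that hk[of x] pos[of x] unfolding k_def by (simp add: mult_less_0_iff)
      show "R - ln y - (1 - 2 * g + 3 * g * y) / (p - g + (2 + p) * g * y) < 0"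
        using that m hk[of y] pos[of y] unfolding k_def by (simp add: mult_less_0_iff)
      show "0 \<le> R - ln m - (1 - 2 * g + 3 * g * m) / (p - g + (2 + p) * g * m)"
        using m hk[of m] pos[of m] unfolding k_def by (simp add: zero_le_mult_iff)
      show "0 < R - ln 1 - (1 - 2 * g + 3 * g * 1) / (p - g + (2 + p) * g * 1)"
        using h1 hk[of 1] pos[of 1] unfolding k_def by (simp add: zero_less_mult_iff)
    qed (use g p_pos that in auto)
    then show "(\<forall>x. 0 < x \<and> x < m \<longrightarrow> 0 \<le> h g x) \<or>
      v g 1 = 0 \<and> (\<forall>\<^sub>F x in at_left 1. 0 < v g x) \<and> (\<forall>x. m < x \<and> x < 1 \<longrightarrow> 0 \<le> h g x)"
      using v1 near_1 by (metis not_less)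
  qed (simp add: v1)
  then show ?thesis by (simp add: v_def g_def)
qed

lemma upper_bound_sharp:
  assumes "\<And>x. 0 < x \<Longrightarrow> x < 1 \<Longrightarrow> Y x < (R - ln x) * (1 + g * x)"
  shows "p \<le> g"
proof (rule ccontr)
  assume "\<not> p \<le> g"
  then interpret f: flux_equation p "v g" "q g" "h g" by (intro flux) simp
  have "\<forall>\<^sub>F x in at_right 0. v g x < 0"
    using assms by (auto simp: v_def eventually_at_right_field intro!: exI[of _ 1])
  then have "\<forall>\<^sub>F x in at_right (0::real). False" using f.pos_near_0 by eventually_elim simp
  then show False by simp
qed

lemma lower_bound_sharp:
  assumes "\<And>x. 0 < x \<Longrightarrow> x < 1 \<Longrightarrow> (R - ln x) * (1 + g * x) < Y x"
  shows "g \<le> t / R - 1"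
proof -
  have "0 \<le> v g 1"
    by (rule tendsto_lowerbound[OF v_limit_1])
       (use assms in \<open>auto simp: v_def eventually_at_left_field less_imp_le intro!: exI[of _ 0]\<close>)
  then show ?thesis using R_ge by (simp add: v_def Y_1 field_simps)
qed

section \<open>Return from x to the modulus r\<close>

lemma ratio_eq:
  assumes r: "0 < r" "r < 1" and x: "x = 1 - r\<^sup>2"
  shows "gen_ellipticK a r / (sin (pi * a) * ln (exp (ramanujan_R a / 2) / compl_modulus r))
    = Y x / (R - ln x)"
proof -
  have r2: "0 < x" "x < 1" using r by (auto simp: x abs_square_less_1)
  have "hypergeo2F1 a (1 - a) 1 (r\<^sup>2) = Y x / t"
  proof -
    have "pochhammer a n * pochhammer (1 - a) n / pochhammer 1 n * (r\<^sup>2) ^ n / fact n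
        = d n * (1 - x) ^ n / t" for n
      using t_pos by (simp add: d_eq x pochhammer_fact[symmetric] power2_eq_square)
    then show ?thesis
      using suminf_divide[OF d_sums_bound[of "1 - x"], of t] r2 by (simp add: hypergeo2F1_def Y_def)
  qed
  then have K: "gen_ellipticK a r = sin (pi * a) / 2 * Y x"
    by (simp add: gen_ellipticK_def t_def)
  \<comment> \<open>As r' is the square root of x, the logarithm is half of R - ln x; this half
    cancels the one in pi/2.\<close>
  have "ln (exp (R / 2) / compl_modulus r) = (R - ln x) / 2"
    using r2 by (simp add: compl_modulus_def x[symmetric] ln_div ln_sqrt)
  then show ?thesis using sin_pos by (simp add: K R_def)
qed

end

theorem theorem1p1:
  fixes a \<alpha> \<beta> :: real
  assumes "0 < a" and "a \<le> 1/2"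
  shows "(\<forall>r. 0 < r \<and> r < 1 \<longrightarrow>
            1 + \<alpha> * (compl_modulus r)\<^sup>2
              < gen_ellipticK a r / (sin (pi * a) * ln (exp (ramanujan_R a / 2) / compl_modulus r))
          \<and> gen_ellipticK a r / (sin (pi * a) * ln (exp (ramanujan_R a / 2) / compl_modulus r))
              < 1 + \<beta> * (compl_modulus r)\<^sup>2)
     \<longleftrightarrow> \<alpha> \<le> pi / (ramanujan_R a * sin (pi * a)) - 1 \<and> \<beta> \<ge> a * (1 - a)"
    (is "(\<forall>r. 0 < r \<and> r < 1 \<longrightarrow> ?P r) \<longleftrightarrow> ?Q")
proof -
  interpret elliptic_parameter a using assms by unfold_locales
  have pos: "0 < R - ln x" if "0 < x" "x < 1" for x
    using R_ge ln_less_zero[of x] that by linarith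
  have P: "?P r \<longleftrightarrow> (R - ln x) * (1 + \<alpha> * x) < Y x \<and> Y x < (R - ln x) * (1 + \<beta> * x)"
    if r: "0 < r" "r < 1" and x: "x = 1 - r\<^sup>2" for r x
  proof -
    have "0 < x" "x < 1" using r by (auto simp: x abs_square_less_1)
    moreover have "(compl_modulus r)\<^sup>2 = x"
      using \<open>0 < x\<close> by (simp add: compl_modulus_def x[symmetric])
    ultimately show ?thesis
      unfolding ratio_eq[OF that] using pos[of x] by (simp add: field_simps)
  qed
  have "(\<forall>r. 0 < r \<and> r < 1 \<longrightarrow> ?P r) \<longleftrightarrow>
      (\<forall>x. 0 < x \<and> x < 1 \<longrightarrow> (R - ln x) * (1 + \<alpha> * x) < Y x \<and> Y x < (R - ln x) * (1 + \<beta> * x))"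
    (is "?L \<longleftrightarrow> (\<forall>x. 0 < x \<and> x < 1 \<longrightarrow> ?P' x)")
  proof (intro iffI allI impI; elim conjE)
    fix x :: real assume L: ?L and x: "0 < x" "x < 1"
    have "?P (sqrt (1 - x))" using L x by simp
    then show "?P' x" using P[of "sqrt (1 - x)" x] x by simp
  next
    fix r :: real assume L: "\<forall>x. 0 < x \<and> x < 1 \<longrightarrow> ?P' x" and r: "0 < r" "r < 1"
    have "0 < 1 - r\<^sup>2" "1 - r\<^sup>2 < 1" using r by (auto simp: abs_square_less_1)
    then show "?P r" using P[OF r refl] L by blast
  qed
  also have "\<dots> \<longleftrightarrow> \<alpha> \<le> t / R - 1 \<and> p \<le> \<beta>"
  proof (intro iffI conjI allI impI; (elim conjE)?)
    assume *: "\<forall>x. 0 < x \<and> x < 1 \<longrightarrow> ?P' x"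
    show "\<alpha> \<le> t / R - 1" by (rule lower_bound_sharp) (use * in blast)
    show "p \<le> \<beta>" by (rule upper_bound_sharp) (use * in blast)
  next
    fix x :: real assume ab: "\<alpha> \<le> t / R - 1" "p \<le> \<beta>" and x: "0 < x" "x < 1"
    have "(R - ln x) * (1 + \<alpha> * x) \<le> (R - ln x) * (1 + (t / R - 1) * x)"
      using pos[OF x] ab x by (intro mult_left_mono add_left_mono mult_right_mono) auto
    then show "(R - ln x) * (1 + \<alpha> * x) < Y x" using lower_bound[OF x] by linarith
    have "(R - ln x) * (1 + p * x) \<le> (R - ln x) * (1 + \<beta> * x)"
      using pos[OF x] ab x by (intro mult_left_mono add_left_mono mult_right_mono) auto
    then show "Y x < (R - ln x) * (1 + \<beta> * x)" using upper_bound[OF x] by linarith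
  qed
  also have "t / R = pi / (ramanujan_R a * sin (pi * a))" by (simp add: t_def R_def)
  finally show ?thesis by (simp only: p_def)
qed

end
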